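(* Let $P$ be the transition matrix of an ergodic Markov chain on $[N]=\{1,\dots,N\}$ with stationary distribution $\pi^*$, and run the RLGL algorithm with $P$ and a (deterministic or random) sequence $\mathbf{G}=(G_0,G_1,\dots)$ of green-light sets, producing $C_t,H_t,\hat\pi_t$. Suppose that there are constants $a>0$ and $\rho>0$ such that $$\mathbb{E}\left(\|C_t\|_1\right)\le a\rho^t,\qquad t\ge 0 .$$ Then for any function $f(t)>0$ with $\lim_{t\to\infty}f(t)=\infty$, $$\mathbb{P}\left(\|C_t\|_1\le f(t)\rho^t\right)=1-o(1)\quad\text{as } t\to\infty .$$ If, in addition, $\inf_{t>0}|H_t\mathbf{1}|>0$ (almost surely, when $\mathbf{G}$ is random), then $$\|\hat\pi_t-\pi^*\|_1=O_{\mathbb{P}}\left(f(t)\rho^t\right)\quad\text{as } t\to\infty .$$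
   Context: Ergodic means irreducible and aperiodic (finite state space). All vectors indexed by states are row vectors in $\mathbb{R}^N$; $\mathbf{1}$ is the column vector of ones; $\|\cdot\|_1$ is the sum of absolute values. RLGL algorithm. The input is a stochastic matrix $P$ and a sequence $\mathbf{G}=(G_0,G_1,\dots)$ of subsets of $[N]$ with $G_0=[N]$; the sets $G_t$, $t\ge1$, may be deterministic or random. For $G\subseteq[N]$ let $I(G)$ be the diagonal matrix with $I(G)_{ii}=1$ if $i\in G$ and all other entries $0$. Start with $C_0=\mathbf{0}$, $H_0=\mathbf{0}$, and $M_0$ a fixed probability distribution on $[N]$ (usually uniform). Recursively, $$M_t=C_tI(G_t)\ (t\ge1),\qquad H_{t+1}=H_t+M_t\ (t\ge0),\qquad C_{t+1}=C_t-M_t(I-P)\ (t\ge0).$$ The estimate of $\pi^*$ is $\hat\pi_t=H_t/(H_t\mathbf{1})$, $t\ge1$ (when $H_t\mathbf{1}\neq0$). For random $Y_t$ and deterministic $g(t)>0$, $Y_t=O_{\mathbb{P}}(g(t))$ as $t\to\infty$ means: for every $\epsilon>0$ there are $K,t_0<\infty$ such that $\mathbb{P}(|Y_t|>Kg(t))\le\epsilon$ for all $t\ge t_0$. *)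

theory Defs
  imports "HOL-Probability.Probability"
begin

text \<open>The state space \<open>[N]\<close> is a finite index type \<open>'n\<close>. Vectors \<open>real ^ 'n\<close> are row vectors and
  act from the left by \<open>(v*)\<close>; \<open>P $ i $ j\<close> is the transition probability from \<open>i\<close> to \<open>j\<close>.\<close>

definition l1_norm :: "real ^ 'n \<Rightarrow> real" where
  "l1_norm v = (\<Sum>i\<in>UNIV. \<bar>v $ i\<bar>)"

text \<open>The product of a row vector with the column vector of ones.\<close>

definition entry_sum :: "real ^ 'n \<Rightarrow> real" where
  "entry_sum v = (\<Sum>i\<in>UNIV. v $ i)"

definition prob_vector :: "real ^ 'n \<Rightarrow> bool" where
  "prob_vector v \<longleftrightarrow> (\<forall>i. 0 \<le> v $ i) \<and> entry_sum v = 1"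

definition stochastic :: "real ^ 'n ^ 'n \<Rightarrow> bool" where
  "stochastic P \<longleftrightarrow> (\<forall>i. prob_vector (P $ i))"

text \<open>Powers with respect to \<open>(**)\<close>; the generic power on \<open>real ^ 'n ^ 'n\<close> is componentwise.\<close>

primrec mat_power :: "real ^ 'n ^ 'n \<Rightarrow> nat \<Rightarrow> real ^ 'n ^ 'n" where
  "mat_power P 0 = mat 1"
| "mat_power P (Suc k) = mat_power P k ** P"

definition irreducible_chain :: "real ^ 'n ^ 'n \<Rightarrow> bool" where
  "irreducible_chain P \<longleftrightarrow> (\<forall>i j. \<exists>k. mat_power P k $ i $ j > 0)"

definition period :: "real ^ 'n ^ 'n \<Rightarrow> 'n \<Rightarrow> nat" where
  "period P i = Gcd {k. k \<ge> 1 \<and> mat_power P k $ i $ i > 0}"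

definition aperiodic_chain :: "real ^ 'n ^ 'n \<Rightarrow> bool" where
  "aperiodic_chain P \<longleftrightarrow> (\<forall>i. period P i = 1)"

definition ergodic_chain :: "real ^ 'n ^ 'n \<Rightarrow> bool" where
  "ergodic_chain P \<longleftrightarrow> stochastic P \<and> irreducible_chain P \<and> aperiodic_chain P"

definition stationary_distribution :: "real ^ 'n ^ 'n \<Rightarrow> real ^ 'n \<Rightarrow> bool" where
  "stationary_distribution P p \<longleftrightarrow> prob_vector p \<and> p v* P = p"

definition diag_ind :: "'n set \<Rightarrow> real ^ 'n ^ 'n" where
  "diag_ind S = (\<chi> i j. if i = j \<and> i \<in> S then 1 else 0)"

text \<open>One run of the algorithm on the matrix \<open>P\<close>, the initial distribution \<open>m\<close> and a realised
  sequence \<open>S\<close> of green-light sets. Since \<open>C\<^sub>0 = 0\<close>, the first move is \<open>m\<close> itself and not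
  \<open>C\<^sub>0 I(S\<^sub>0)\<close>.\<close>

fun rlgl_C :: "real ^ 'n ^ 'n \<Rightarrow> real ^ 'n \<Rightarrow> (nat \<Rightarrow> 'n set) \<Rightarrow> nat \<Rightarrow> real ^ 'n"
  and rlgl_M :: "real ^ 'n ^ 'n \<Rightarrow> real ^ 'n \<Rightarrow> (nat \<Rightarrow> 'n set) \<Rightarrow> nat \<Rightarrow> real ^ 'n" where
  "rlgl_C P m S 0 = 0"
| "rlgl_C P m S (Suc t) = rlgl_C P m S t - rlgl_M P m S t v* (mat 1 - P)"
| "rlgl_M P m S 0 = m"
| "rlgl_M P m S (Suc t) = rlgl_C P m S (Suc t) v* diag_ind (S (Suc t))"

primrec rlgl_H :: "real ^ 'n ^ 'n \<Rightarrow> real ^ 'n \<Rightarrow> (nat \<Rightarrow> 'n set) \<Rightarrow> nat \<Rightarrow> real ^ 'n" where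
  "rlgl_H P m S 0 = 0"
| "rlgl_H P m S (Suc t) = rlgl_H P m S t + rlgl_M P m S t"

definition rlgl_estimate ::
    "real ^ 'n ^ 'n \<Rightarrow> real ^ 'n \<Rightarrow> (nat \<Rightarrow> 'n set) \<Rightarrow> nat \<Rightarrow> real ^ 'n" where
  "rlgl_estimate P m S t = rlgl_H P m S t /\<^sub>R entry_sum (rlgl_H P m S t)"

text \<open>\<open>Y\<^sub>t = O\<^sub>\<P>(g(t))\<close>. Measurability is required explicitly, because \<open>measure\<close> is \<open>0\<close> on
  non-measurable sets.\<close>

definition bigo_prob :: "'w measure \<Rightarrow> (nat \<Rightarrow> 'w \<Rightarrow> real) \<Rightarrow> (nat \<Rightarrow> real) \<Rightarrow> bool" where
  "bigo_prob M Y g \<longleftrightarrow> (\<forall>t. Y t \<in> borel_measurable M) \<and>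
     (\<forall>\<epsilon>>0. \<exists>K t0. \<forall>t\<ge>t0. measure M {\<omega> \<in> space M. \<bar>Y t \<omega>\<bar> > K * g t} \<le> \<epsilon>)"

end

theory Submission
  imports Defs
begin

text \<open>Telescoping the recursion gives \<open>C\<^sub>t = - H\<^sub>t (I - P)\<close>. Hence the error \<open>v\<close> of the estimate has
  entry sum zero and satisfies \<open>v (I - P) = - C\<^sub>t / (H\<^sub>t 1)\<close>. For an irreducible stochastic \<open>P\<close> the map
  \<open>v \<mapsto> v (I - P)\<close> is injective on the vectors with entry sum zero, hence bounded below there, so the
  error is at most \<open>L \<parallel>C\<^sub>t\<parallel> / |H\<^sub>t 1|\<close> for a constant \<open>L\<close>. Markov's inequality controls \<open>C\<^sub>t\<close>, and the
  infimum of \<open>|H\<^sub>t 1|\<close> exceeds some \<open>\<delta> > 0\<close> outside an event of small probability.\<close>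

section \<open>Norms and entry sums of row vectors\<close>

lemma l1_norm_nonneg [simp]: "0 \<le> l1_norm v"
  by (simp add: l1_norm_def sum_nonneg)

lemma norm_le_l1_norm: "norm v \<le> l1_norm v"
  by (simp add: l1_norm_def norm_le_l1_cart)

lemma l1_norm_le_norm: "l1_norm (v :: real ^ 'n) \<le> real CARD('n) * norm v"
  unfolding l1_norm_def by (rule sum_bounded_above[where K = "norm v", simplified]) (rule component_le_norm_cart)

lemma linear_entry_sum: "linear entry_sum"
  by (rule linearI) (simp_all add: entry_sum_def sum.distrib sum_distrib_left)

lemma entry_sum_mult_stochastic:
  assumes "stochastic P"
  shows "entry_sum (v v* P) = entry_sum v"
proof -
  have row: "(\<Sum>j\<in>UNIV. P $ i $ j) = 1" for i
    using assms by (simp add: stochastic_def prob_vector_def entry_sum_def)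
  have "entry_sum (v v* P) = (\<Sum>i\<in>UNIV. \<Sum>j\<in>UNIV. v $ i * P $ i $ j)"
    unfolding entry_sum_def vector_matrix_mult_def vec_lambda_beta by (rule sum.swap)
  also have "\<dots> = entry_sum v"
    by (simp add: sum_distrib_left[symmetric] row entry_sum_def)
  finally show ?thesis .
qed

section \<open>Fixed vectors of an irreducible stochastic matrix\<close>

lemma mat_power_nonneg:
  assumes "stochastic P"
  shows "0 \<le> mat_power P k $ i $ j"
proof (induction k arbitrary: i j)
  case (Suc k)
  have "0 \<le> P $ l $ j" for l
    using assms by (simp add: stochastic_def prob_vector_def)
  with Suc show ?case
    by (auto simp: matrix_matrix_mult_def intro!: sum_nonneg)
qed (simp add: mat_def)

lemma fixed_mat_power:
  assumes "w v* P = w"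
  shows "w v* mat_power P k = w"
  by (induction k) (simp_all add: vector_matrix_mul_assoc[symmetric] assms)

text \<open>Entry \<open>i\<close> of \<open>w v* mat_power P k\<close> is a sum of nonnegative
  terms, so its vanishing kills every term; irreducibility supplies for each \<open>j\<close> a
  power whose \<open>j\<close>-\<open>i\<close> entry is positive.\<close>

lemma nonneg_fixed_eq_0:
  assumes P: "stochastic P" "irreducible_chain P" and fixed: "w v* P = w"
    and nonneg: "\<And>i. 0 \<le> w $ i" and zero: "w $ i = 0"
  shows "w = 0"
proof -
  have "w $ j = 0" for j
  proof -
    obtain k where k: "mat_power P k $ j $ i > 0"
      using P(2) by (auto simp: irreducible_chain_def)
    have "(\<Sum>j\<in>UNIV. w $ j * mat_power P k $ j $ i) = (w v* mat_power P k) $ i"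
      by (simp add: vector_matrix_mult_def)
    also have "\<dots> = 0"
      using fixed_mat_power[OF fixed] zero by simp
    finally have "\<forall>j\<in>UNIV. w $ j * mat_power P k $ j $ i = 0"
      by (subst (asm) sum_nonneg_eq_0_iff) (auto simp: nonneg mat_power_nonneg[OF P(1)])
    with k show ?thesis by (metis UNIV_I less_irrefl mult_eq_0_iff)
  qed
  then show ?thesis by (simp add: vec_eq_iff)
qed

text \<open>The triangle inequality gives one coordinatewise inequality between the two sides; their
  entry sums agree because \<open>P\<close> is stochastic, which leaves no slack in any
  coordinate.\<close>

lemma abs_fixed:
  assumes P: "stochastic P" and fixed: "v v* P = v"
  shows "(\<chi> i. \<bar>v $ i\<bar>) v* P = (\<chi> i. \<bar>v $ i\<bar>)"
proof -
  let ?u = "\<chi> i. \<bar>v $ i\<bar>"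
  have pos: "0 \<le> P $ i $ j" for i j
    using P by (simp add: stochastic_def prob_vector_def)
  have le: "?u $ j \<le> (?u v* P) $ j" for j
  proof -
    have "?u $ j = \<bar>(v v* P) $ j\<bar>"
      by (simp add: fixed)
    also have "\<dots> \<le> (\<Sum>i\<in>UNIV. \<bar>v $ i * P $ i $ j\<bar>)"
      by (simp add: vector_matrix_mult_def)
    also have "\<dots> = (?u v* P) $ j"
      by (simp add: vector_matrix_mult_def abs_mult pos)
    finally show ?thesis .
  qed
  have "(\<Sum>j\<in>UNIV. (?u v* P) $ j - ?u $ j) = 0"
    using entry_sum_mult_stochastic[OF P, of ?u] unfolding entry_sum_def sum_subtractf by simp
  then have "\<forall>j\<in>UNIV. (?u v* P) $ j - ?u $ j = 0"
    by (subst (asm) sum_nonneg_eq_0_iff) (use le in auto)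
  then show ?thesis by (simp add: vec_eq_iff)
qed

text \<open>A nonzero \<open>v\<close> with entry sum zero has a positive entry. There the
  nonnegative fixed vector \<open>|v| - v\<close> vanishes, hence it vanishes everywhere; then
  \<open>v\<close> is nonnegative with a positive entry, against its entry sum.\<close>

lemma fixed_entry_sum_0:
  assumes P: "stochastic P" "irreducible_chain P" and fixed: "v v* P = v"
    and zero: "entry_sum v = 0"
  shows "v = 0"
proof (rule ccontr)
  assume "v \<noteq> 0"
  let ?w = "(\<chi> i. \<bar>v $ i\<bar>) - v"
  have "\<exists>i. 0 < v $ i"
  proof (rule ccontr)
    assume "\<not> ?thesis"
    then have "\<forall>i. 0 \<le> - v $ i" by (simp add: not_less)
    moreover have "(\<Sum>i\<in>UNIV. - v $ i) = 0"
      using zero by (simp add: entry_sum_def sum_negf)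
    ultimately have "\<forall>i. v $ i = 0"
      by (subst (asm) sum_nonneg_eq_0_iff) auto
    with \<open>v \<noteq> 0\<close> show False by (simp add: vec_eq_iff)
  qed
  then obtain i where i: "0 < v $ i" by blast
  have "?w = 0"
  proof (rule nonneg_fixed_eq_0[OF P])
    show "?w v* P = ?w"
      by (simp add: vector_matrix_mult_diff_distrib abs_fixed[OF P(1) fixed] fixed)
    show "?w $ i = 0" using i by simp
  qed simp
  then have "\<forall>j. \<bar>v $ j\<bar> = v $ j"
    by (simp add: vec_eq_iff)
  then have "0 \<le> v $ j" for j
    by (metis abs_ge_zero)
  then have "v $ i \<le> entry_sum v"
    unfolding entry_sum_def by (intro member_le_sum) auto
  with i zero show False by simp
qed

section \<open>From the residual to the error of the estimate\<close>

lemma l1_norm_le_l1_norm_residual: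
  fixes P :: "real ^ 'n ^ 'n"
  assumes P: "stochastic P" "irreducible_chain P"
  obtains L where "L > 0"
    "\<And>v. entry_sum v = 0 \<Longrightarrow> l1_norm v \<le> L * l1_norm (v v* (mat 1 - P))"
proof -
  \<comment> \<open>Recording the entry sum as a second component makes the map injective on the
    whole space, so the lower bound for injective linear maps in finite dimension applies without
    passing to a subspace.\<close>
  let ?T = "\<lambda>v. (v v* (mat 1 - P), entry_sum v)"
  have lin: "linear ?T"
    by (rule linearI)
      (simp_all add: vector_matrix_left_distrib scaleR_vector_matrix_assoc
        linear_add[OF linear_entry_sum] linear_cmul[OF linear_entry_sum])
  have "inj ?T"
    unfolding linear_injective_0[OF lin]
    using fixed_entry_sum_0[OF P] by (auto simp: vector_matrix_mult_diff_rdistrib zero_prod_def)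
  then obtain B where B: "B > 0" "\<And>v. B * norm v \<le> norm (?T v)"
    using linear_inj_bounded_below_pos[OF lin] by blast
  show thesis
  proof
    \<comment> \<open>The factor \<open>CARD('n)\<close> is the cost of passing from the Euclidean
      norm to the l1 norm.\<close>
    show "real CARD('n) / B > 0" using B(1) by simp
    fix v :: "real ^ 'n"
    assume "entry_sum v = 0"
    then have "B * norm v \<le> l1_norm (v v* (mat 1 - P))"
      using B(2)[of v] norm_le_l1_norm[of "v v* (mat 1 - P)"] by (simp add: norm_Pair)
    then have "norm v \<le> l1_norm (v v* (mat 1 - P)) / B"
      using B(1) by (simp add: field_simps)
    then have "real CARD('n) * norm v \<le> real CARD('n) * (l1_norm (v v* (mat 1 - P)) / B)"
      by (intro mult_left_mono) auto
    then show "l1_norm v \<le> real CARD('n) / B * l1_norm (v v* (mat 1 - P))"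
      using l1_norm_le_norm[of v] by simp
  qed
qed

lemma rlgl_C_eq: "rlgl_C P m S t = - (rlgl_H P m S t v* (mat 1 - P))"
  by (induction t) (simp_all add: vector_matrix_left_distrib)

text \<open>The stationary vector is annihilated by \<open>mat 1 - P\<close>, so the residual of the
  error is that of the normalised \<open>H\<close>, namely \<open>C\<close> rescaled up to
  sign.\<close>

lemma rlgl_estimate_error_le:
  assumes P: "stochastic P" and p: "stationary_distribution P p"
    and L: "\<And>v. entry_sum v = 0 \<Longrightarrow> l1_norm v \<le> L * l1_norm (v v* (mat 1 - P))"
    and h: "entry_sum (rlgl_H P m S t) \<noteq> 0"
  shows "l1_norm (rlgl_estimate P m S t - p)
    \<le> L * l1_norm (rlgl_C P m S t) / \<bar>entry_sum (rlgl_H P m S t)\<bar>"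
proof -
  let ?h = "entry_sum (rlgl_H P m S t)" and ?v = "rlgl_estimate P m S t - p"
  have "entry_sum ?v = 0"
    using p h by (simp add: rlgl_estimate_def stationary_distribution_def prob_vector_def
        linear_diff[OF linear_entry_sum] linear_cmul[OF linear_entry_sum])
  then have "l1_norm ?v \<le> L * l1_norm (?v v* (mat 1 - P))"
    by (rule L)
  also have "?v v* (mat 1 - P) = - (rlgl_C P m S t /\<^sub>R ?h)"
    using p by (simp add: rlgl_estimate_def stationary_distribution_def rlgl_C_eq
        vector_matrix_mult_diff_distrib scaleR_vector_matrix_assoc vector_matrix_mult_diff_rdistrib
        scaleR_diff_right)
  also have "l1_norm \<dots> = l1_norm (rlgl_C P m S t) / \<bar>?h\<bar>"
    by (simp add: l1_norm_def abs_mult sum_distrib_left divide_inverse mult.commute)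
  finally show ?thesis by simp
qed

section \<open>Measurability and tail bounds\<close>

text \<open>Up to a fixed time a run depends on finitely many subsets of a finite type, hence takes
  finitely many values. This yields measurability and integrability at once.\<close>

lemma simple_function_rlgl:
  fixes P :: "real ^ 'n ^ 'n" and G :: "nat \<Rightarrow> 'w \<Rightarrow> 'n set"
  assumes G: "\<And>t. G t \<in> M \<rightarrow>\<^sub>M count_space UNIV"
  shows "simple_function M (\<lambda>\<omega>. rlgl_C P m (\<lambda>s. G s \<omega>) t)"
    and "simple_function M (\<lambda>\<omega>. rlgl_M P m (\<lambda>s. G s \<omega>) t)"
proof (induction t)
  case (Suc t)
  have G': "simple_function M (G (Suc t))"
    by (simp add: simple_function_eq_measurable G)
  {
    case 1
    show ?case
      using simple_function_compose2[OF Suc, of "\<lambda>c r. c - r v* (mat 1 - P)"] by simp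
  }
  note C = this
  {
    case 2
    \<comment> \<open>The move at \<open>Suc t\<close> reads \<open>C\<close> at the same time, so
      the first claim is reused and \<open>rlgl_C\<close> stays folded.\<close>
    show ?case
      using simple_function_compose2[OF C G', of "\<lambda>c S. c v* diag_ind S"]
      by (simp del: rlgl_C.simps)
  }
qed simp_all

lemma simple_function_rlgl_H:
  fixes P :: "real ^ 'n ^ 'n" and G :: "nat \<Rightarrow> 'w \<Rightarrow> 'n set"
  assumes G: "\<And>t. G t \<in> M \<rightarrow>\<^sub>M count_space UNIV"
  shows "simple_function M (\<lambda>\<omega>. rlgl_H P m (\<lambda>s. G s \<omega>) t)"
proof (induction t)
  case (Suc t)
  show ?case
    using simple_function_compose2[OF Suc simple_function_rlgl(2)[OF G], of "(+)"] by simp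
qed simp

lemma (in finite_measure) simple_function_integrable:
  fixes u :: "'a \<Rightarrow> real"
  assumes "simple_function M u"
  shows "integrable M u"
  by (rule integrable_simple_function) (use assms in simp_all)

text \<open>Continuity from above: the events \<open>X \<omega> \<le> 1 / Suc n\<close> decrease to
  a null event. This replaces the uniform lower bound that almost sure positivity does not
  give.\<close>

lemma (in prob_space) bounded_away_from_0:
  fixes X :: "'a \<Rightarrow> real"
  assumes X [measurable]: "X \<in> borel_measurable M" and pos: "AE \<omega> in M. 0 < X \<omega>" and "\<epsilon> > 0"
  obtains \<delta> where "\<delta> > 0" "prob {\<omega> \<in> space M. X \<omega> \<le> \<delta>} < \<epsilon>"
proof -
  let ?A = "\<lambda>n. {\<omega> \<in> space M. X \<omega> \<le> 1 / real (Suc n)}"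
  have "(\<lambda>n. prob (?A n)) \<longlonglongrightarrow> prob (\<Inter>n. ?A n)"
  proof (rule finite_Lim_measure_decseq)
    show "decseq ?A"
      by (intro decseq_SucI) (auto elim!: order_trans intro!: divide_left_mono)
  qed auto
  also have "prob (\<Inter>n. ?A n) = 0"
  proof -
    have "AE \<omega> in M. \<omega> \<notin> (\<Inter>n. ?A n)"
      using pos
    proof eventually_elim
      case (elim \<omega>)
      then obtain n where "1 / real (Suc n) < X \<omega>"
        using nat_approx_posE by blast
      then show ?case by (auto simp: not_le intro!: exI[of _ n])
    qed
    then show ?thesis by (subst prob_eq_0) auto
  qed
  finally have "eventually (\<lambda>n. prob (?A n) < \<epsilon>) sequentially"
    using \<open>\<epsilon> > 0\<close> by (rule order_tendstoD)
  then obtain n where "prob (?A n) < \<epsilon>"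
    by (auto simp: eventually_sequentially)
  with that[of "1 / real (Suc n)"] show thesis by simp
qed

theorem lemma2:
  fixes P :: "real ^ 'n ^ 'n" and pi_star m :: "real ^ 'n"
    and M :: "'w measure" and G :: "nat \<Rightarrow> 'w \<Rightarrow> 'n set"
    and a \<rho> :: real and f :: "nat \<Rightarrow> real"
  assumes "ergodic_chain P" and "stationary_distribution P pi_star"
    and "prob_vector m"
    and "prob_space M"
    and "\<And>t. G t \<in> M \<rightarrow>\<^sub>M count_space UNIV"
    and "\<And>\<omega>. \<omega> \<in> space M \<Longrightarrow> G 0 \<omega> = UNIV"
    and "a > 0" and "\<rho> > 0"
    and "\<And>t. (\<integral>\<omega>. l1_norm (rlgl_C P m (\<lambda>s. G s \<omega>) t) \<partial>M) \<le> a * \<rho> ^ t"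
    and "\<And>t. f t > 0" and "filterlim f at_top sequentially"
  shows "(\<lambda>t. 1 - measure M {\<omega> \<in> space M. l1_norm (rlgl_C P m (\<lambda>s. G s \<omega>) t) \<le> f t * \<rho> ^ t})
           \<in> o(\<lambda>_. 1) \<and>
    ((AE \<omega> in M. (INF t\<in>{0<..}. \<bar>entry_sum (rlgl_H P m (\<lambda>s. G s \<omega>) t)\<bar>) > 0) \<longrightarrow>
       bigo_prob M (\<lambda>t \<omega>. l1_norm (rlgl_estimate P m (\<lambda>s. G s \<omega>) t - pi_star))
         (\<lambda>t. f t * \<rho> ^ t))"
proof -
  interpret prob_space M by fact
  have P: "stochastic P" "irreducible_chain P"
    using assms(1) by (simp_all add: ergodic_chain_def)
  let ?C = "\<lambda>t \<omega>. l1_norm (rlgl_C P m (\<lambda>s. G s \<omega>) t)"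
  let ?h = "\<lambda>t \<omega>. \<bar>entry_sum (rlgl_H P m (\<lambda>s. G s \<omega>) t)\<bar>"
  let ?Y = "\<lambda>t \<omega>. l1_norm (rlgl_estimate P m (\<lambda>s. G s \<omega>) t - pi_star)"
  have C_simple: "simple_function M (?C t)" for t
    using simple_function_compose[OF simple_function_rlgl(1)[OF assms(5)], of l1_norm]
    by (simp add: comp_def)
  have h_simple: "simple_function M (?h t)" for t
    using simple_function_compose[OF simple_function_rlgl_H[OF assms(5)], of "\<lambda>H. \<bar>entry_sum H\<bar>"]
    by (simp add: comp_def)
  \<comment> \<open>Division is total, so the estimate is a function of \<open>H\<close> even where
    the entry sum is 0.\<close>
  have Y_simple: "simple_function M (?Y t)" for t
    using simple_function_compose[OF simple_function_rlgl_H[OF assms(5)],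
        of "\<lambda>H. l1_norm (H /\<^sub>R entry_sum H - pi_star)"]
    by (simp add: comp_def rlgl_estimate_def)
  note [measurable] = borel_measurable_simple_function[OF C_simple]
    borel_measurable_simple_function[OF h_simple] borel_measurable_simple_function[OF Y_simple]
  let ?bad = "\<lambda>t. {\<omega> \<in> space M. f t * \<rho> ^ t < ?C t \<omega>}"
  have bad_le: "prob (?bad t) \<le> a / f t" for t
  proof -
    have pos: "0 < f t * \<rho> ^ t"
      using assms(8,10) by simp
    have "prob (?bad t) \<le> prob {\<omega> \<in> space M. f t * \<rho> ^ t \<le> ?C t \<omega>}"
      by (intro finite_measure_mono) auto
    also have "\<dots> \<le> (\<integral>\<omega>. ?C t \<omega> \<partial>M) / (f t * \<rho> ^ t)"
      \<comment> \<open>Integrability matters here: the integral of a non-integrable function would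
        be 0 by default.\<close>
      by (rule integral_Markov_inequality_measure[where A = "space M"])
        (use pos simple_function_integrable[OF C_simple] in auto)
    also have "\<dots> \<le> a * \<rho> ^ t / (f t * \<rho> ^ t)"
      using assms(9)[of t] pos by (intro divide_right_mono) auto
    finally show ?thesis using assms(8) by simp
  qed
  have "(\<lambda>t. a / f t) \<longlonglongrightarrow> 0"
    using assms(11) by (intro tendsto_divide_0[OF tendsto_const] filterlim_at_top_imp_at_infinity)
  then have bad_lim: "(\<lambda>t. prob (?bad t)) \<longlonglongrightarrow> 0"
    by (rule tendsto_sandwich[OF _ _ tendsto_const, rotated 2]) (simp_all add: bad_le)
  have "prob (?bad t) = 1 - prob {\<omega> \<in> space M. ?C t \<omega> \<le> f t * \<rho> ^ t}" for t
    using prob_neg[of "\<lambda>\<omega>. ?C t \<omega> \<le> f t * \<rho> ^ t"] by (simp add: not_le)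
  with bad_lim have first:
    "(\<lambda>t. 1 - prob {\<omega> \<in> space M. ?C t \<omega> \<le> f t * \<rho> ^ t}) \<in> o(\<lambda>_. 1)"
    by (intro smalloI_tendsto) simp_all
  moreover have "bigo_prob M ?Y (\<lambda>t. f t * \<rho> ^ t)"
    if pos: "AE \<omega> in M. (INF t\<in>{0<..}. ?h t \<omega>) > 0"
    unfolding bigo_prob_def
  proof (intro conjI allI impI)
    fix \<epsilon> :: real
    assume "\<epsilon> > 0"
    obtain L where L: "L > 0"
      "\<And>v. entry_sum v = 0 \<Longrightarrow> l1_norm v \<le> L * l1_norm (v v* (mat 1 - P))"
      using l1_norm_le_l1_norm_residual[OF P] by blast
    let ?X = "\<lambda>\<omega>. INF t\<in>{0<..}. ?h t \<omega>"
    \<comment> \<open>A real \<open>INF\<close> is meaningful only for sets bounded below; absolute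
      values have the bound 0.\<close>
    have bdd: "bdd_below ((\<lambda>t. ?h t \<omega>) ` A)" for \<omega> A
      by (rule bdd_belowI2[of _ 0]) simp
    have [measurable]: "?X \<in> borel_measurable M"
      by (rule borel_measurable_cINF) (use bdd in auto)
    obtain \<delta> where \<delta>: "\<delta> > 0" "prob {\<omega> \<in> space M. ?X \<omega> \<le> \<delta>} < \<epsilon> / 2"
      using bounded_away_from_0[OF _ pos, of "\<epsilon> / 2"] \<open>\<epsilon> > 0\<close> by auto
    have "eventually (\<lambda>t. prob (?bad t) < \<epsilon> / 2) sequentially"
      using \<open>\<epsilon> > 0\<close> by (intro order_tendstoD(2)[OF bad_lim]) simp
    then obtain t0 where t0: "\<And>t. t \<ge> t0 \<Longrightarrow> prob (?bad t) < \<epsilon> / 2"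
      by (auto simp: eventually_sequentially)
    \<comment> \<open>The constant is \<open>K = L / \<delta>\<close>, where \<open>L\<close>
      depends on \<open>P\<close> alone. Starting at \<open>Suc t0\<close> forces
      \<open>t > 0\<close>, so that \<open>t\<close> lies in the range of the infimum.\<close>
    have "prob {\<omega> \<in> space M. \<bar>?Y t \<omega>\<bar> > L / \<delta> * (f t * \<rho> ^ t)} \<le> \<epsilon>" if t: "t \<ge> Suc t0" for t
    proof -
      have Y_le: "\<bar>?Y t \<omega>\<bar> \<le> L / \<delta> * (f t * \<rho> ^ t)"
        if "\<delta> < ?X \<omega>" and C: "?C t \<omega> \<le> f t * \<rho> ^ t" for \<omega>
      proof -
        have h: "\<delta> < ?h t \<omega>"
          using that(1) cINF_lower[OF bdd, of t "{0<..}" \<omega>] t by simp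
        then have "?Y t \<omega> \<le> L * ?C t \<omega> / ?h t \<omega>"
          using \<delta>(1) by (intro rlgl_estimate_error_le[OF P(1) assms(2) L(2)]) auto
        also have "\<dots> \<le> L * (f t * \<rho> ^ t) / \<delta>"
          using h L(1) \<delta>(1) C assms(8) less_imp_le[OF assms(10)]
          by (intro frac_le mult_left_mono) auto
        finally show ?thesis by simp
      qed
      have "{\<omega> \<in> space M. \<bar>?Y t \<omega>\<bar> > L / \<delta> * (f t * \<rho> ^ t)}
          \<subseteq> {\<omega> \<in> space M. ?X \<omega> \<le> \<delta>} \<union> ?bad t"
      proof
        fix \<omega>
        assume "\<omega> \<in> {\<omega> \<in> space M. \<bar>?Y t \<omega>\<bar> > L / \<delta> * (f t * \<rho> ^ t)}"
        then have \<omega>: "\<omega> \<in> space M" and "\<not> \<bar>?Y t \<omega>\<bar> \<le> L / \<delta> * (f t * \<rho> ^ t)"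
          by (simp_all only: mem_Collect_eq not_le)
        then have "\<not> \<delta> < ?X \<omega> \<or> \<not> ?C t \<omega> \<le> f t * \<rho> ^ t"
          using Y_le by blast
        with \<omega> show "\<omega> \<in> {\<omega> \<in> space M. ?X \<omega> \<le> \<delta>} \<union> ?bad t"
          by (simp only: Un_iff mem_Collect_eq not_less not_le simp_thms)
      qed
      then have "prob {\<omega> \<in> space M. \<bar>?Y t \<omega>\<bar> > L / \<delta> * (f t * \<rho> ^ t)}
          \<le> prob ({\<omega> \<in> space M. ?X \<omega> \<le> \<delta>} \<union> ?bad t)"
        by (intro finite_measure_mono) auto
      also have "\<dots> \<le> prob {\<omega> \<in> space M. ?X \<omega> \<le> \<delta>} + prob (?bad t)"
        by (intro measure_Un_le) auto
      also have "\<dots> \<le> \<epsilon>"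
        using \<delta>(2) t0[of t] t by simp
      finally show ?thesis .
    qed
    then show "\<exists>K t0. \<forall>t\<ge>t0. prob {\<omega> \<in> space M. \<bar>?Y t \<omega>\<bar> > K * (f t * \<rho> ^ t)} \<le> \<epsilon>"
      by blast
  \<comment> \<open>What remains is the measurability conjunct of \<open>bigo_prob\<close>.\<close>
  qed measurable
  ultimately show ?thesis by blast
qed

end
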